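(* Let $(H,\mu,\Delta,\nu,\varepsilon,S)$ be a cocommutative Hopf algebra in a symmetric category $(\mathcal{C},\otimes,\mathbf{I},c)$. Define $$\lhd_H=\mu^2\circ S_1\circ c_1\circ\Delta_2:H\otimes H\to H,\qquad\widetilde{\lhd}_H=\lhd_H\circ(S^{-1})_2:H\otimes H\to H.$$ Then $(H,\Delta,\varepsilon,\lhd_H,\widetilde{\lhd}_H)$ satisfies all the conditions in the definition of a rack in $\mathcal{C}$; consequently $H$ is endowed with the specific braiding $(\lhd_H)_2\circ c_1\circ\Delta_2:H\otimes H\to H\otimes H$.
   Context: All monoidal categories are strict; a symmetric category is a strict symmetric monoidal category. For $\varphi:V^{\otimes l}\to V^{\otimes r}$, $\varphi_i:=\operatorname{Id}_V^{\otimes(i-1)}\otimes\varphi\otimes\operatorname{Id}_V^{\otimes(k-i+1)}:V^{\otimes(k+l)}\to V^{\otimes(k+r)}$, and $\varphi^n:=\varphi_1\circ\cdots\circ\varphi_1$ ($n$ times). $c$ means $c_{V,V}$. Cocommutative means $c\circ\Delta=\Delta$. A shelf in $\mathcal{C}$ is an object $V$ with $\Delta:V\to V\otimes V$, $\lhd:V\otimes V\to V$ such that: (1) $\Delta_1\circ\Delta=\Delta_2\circ\Delta$ and $c_2\circ\Delta^3=\Delta^3:V\to V^{\otimes4}$; (2) $\lhd^2=\lhd\circ(\lhd\otimes\lhd)\circ c_2\circ\Delta_3:V^{\otimes3}\to V$; (3) $\Delta\circ\lhd=(\lhd\otimes\lhd)\circ c_2\circ(\Delta\otimes\Delta)$.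 A rack is a shelf with moreover $\varepsilon:V\to\mathbf{I}$ satisfying $\varepsilon_2\circ\Delta=\operatorname{Id}_V$, and $\widetilde{\lhd}:V\otimes V\to V$ with $\widetilde{\lhd}\circ\lhd_1\circ c_2\circ\Delta_2=\lhd\circ\widetilde{\lhd}_1\circ c_2\circ\Delta_2=\operatorname{Id}_V\otimes\varepsilon:V^{\otimes2}\to V$. A specific braiding on $V$ is an invertible $\sigma:V\otimes V\to V\otimes V$ with $\sigma_1\sigma_2\sigma_1=\sigma_2\sigma_1\sigma_2$ on $V^{\otimes3}$. *)

theory Defs
  imports Main
begin

record ('o, 'm) monoidal_data =
  Obj :: "'o set"
  Arr :: "'m set"
  Dom :: "'m \<Rightarrow> 'o"
  Cod :: "'m \<Rightarrow> 'o"
  Id :: "'o \<Rightarrow> 'm"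
  Comp :: "'m \<Rightarrow> 'm \<Rightarrow> 'm"  (infixr "\<cdot>\<index>" 60)
  Tens_obj :: "'o \<Rightarrow> 'o \<Rightarrow> 'o"  (infixr "\<otimes>\<^sub>o\<index>" 70)
  Tens :: "'m \<Rightarrow> 'm \<Rightarrow> 'm"  (infixr "\<otimes>\<index>" 70)
  Unit :: "'o"  ("\<I>\<index>")
  Sym :: "'o \<Rightarrow> 'o \<Rightarrow> 'm"

definition Hom :: "('o, 'm, 'z) monoidal_data_scheme \<Rightarrow> 'o \<Rightarrow> 'o \<Rightarrow> 'm set" where
  "Hom C A B = {f \<in> Arr C. Dom C f = A \<and> Cod C f = B}"

locale category =
  fixes C :: "('o, 'm, 'z) monoidal_data_scheme" (structure)
  assumes Dom_in_Obj: "f \<in> Arr C \<Longrightarrow> Dom C f \<in> Obj C"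
    and Cod_in_Obj: "f \<in> Arr C \<Longrightarrow> Cod C f \<in> Obj C"
    and Id_in_Hom: "A \<in> Obj C \<Longrightarrow> Id C A \<in> Hom C A A"
    and Comp_in_Hom: "\<lbrakk>g \<in> Hom C A B; h \<in> Hom C B D\<rbrakk> \<Longrightarrow> h \<cdot> g \<in> Hom C A D"
    and Comp_Id_left: "f \<in> Hom C A B \<Longrightarrow> Id C B \<cdot> f = f"
    and Comp_Id_right: "f \<in> Hom C A B \<Longrightarrow> f \<cdot> Id C A = f"
    and Comp_assoc: "\<lbrakk>f \<in> Hom C A B; g \<in> Hom C B D; h \<in> Hom C D E\<rbrakk>
      \<Longrightarrow> (h \<cdot> g) \<cdot> f = h \<cdot> (g \<cdot> f)"

locale strict_monoidal_category = category +
  assumes Unit_in_Obj: "\<I> \<in> Obj C"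
    and Tens_obj_in_Obj: "\<lbrakk>A \<in> Obj C; B \<in> Obj C\<rbrakk> \<Longrightarrow> A \<otimes>\<^sub>o B \<in> Obj C"
    and Tens_in_Hom: "\<lbrakk>f \<in> Hom C A B; g \<in> Hom C A' B'\<rbrakk>
      \<Longrightarrow> f \<otimes> g \<in> Hom C (A \<otimes>\<^sub>o A') (B \<otimes>\<^sub>o B')"
    and Tens_Id: "\<lbrakk>A \<in> Obj C; B \<in> Obj C\<rbrakk> \<Longrightarrow> Id C A \<otimes> Id C B = Id C (A \<otimes>\<^sub>o B)"
    and interchange: "\<lbrakk>f \<in> Hom C A B; g \<in> Hom C B D; f' \<in> Hom C A' B'; g' \<in> Hom C B' D'\<rbrakk>
      \<Longrightarrow> (g \<cdot> f) \<otimes> (g' \<cdot> f') = (g \<otimes> g') \<cdot> (f \<otimes> f')"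
    and Tens_obj_assoc: "\<lbrakk>A \<in> Obj C; B \<in> Obj C; D \<in> Obj C\<rbrakk>
      \<Longrightarrow> (A \<otimes>\<^sub>o B) \<otimes>\<^sub>o D = A \<otimes>\<^sub>o (B \<otimes>\<^sub>o D)"
    and Tens_assoc: "\<lbrakk>f \<in> Arr C; g \<in> Arr C; h \<in> Arr C\<rbrakk>
      \<Longrightarrow> (f \<otimes> g) \<otimes> h = f \<otimes> (g \<otimes> h)"
    and Tens_obj_Unit_left: "A \<in> Obj C \<Longrightarrow> \<I> \<otimes>\<^sub>o A = A"
    and Tens_obj_Unit_right: "A \<in> Obj C \<Longrightarrow> A \<otimes>\<^sub>o \<I> = A"
    and Tens_Unit_left: "f \<in> Arr C \<Longrightarrow> Id C \<I> \<otimes> f = f"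
    and Tens_Unit_right: "f \<in> Arr C \<Longrightarrow> f \<otimes> Id C \<I> = f"

locale symmetric_category = strict_monoidal_category +
  assumes Sym_in_Hom: "\<lbrakk>A \<in> Obj C; B \<in> Obj C\<rbrakk>
      \<Longrightarrow> Sym C A B \<in> Hom C (A \<otimes>\<^sub>o B) (B \<otimes>\<^sub>o A)"
    and Sym_natural: "\<lbrakk>f \<in> Hom C A B; g \<in> Hom C A' B'\<rbrakk>
      \<Longrightarrow> Sym C B B' \<cdot> (f \<otimes> g) = (g \<otimes> f) \<cdot> Sym C A A'"
    and Sym_Tens_right: "\<lbrakk>A \<in> Obj C; B \<in> Obj C; D \<in> Obj C\<rbrakk>
      \<Longrightarrow> Sym C A (B \<otimes>\<^sub>o D) = (Id C B \<otimes> Sym C A D) \<cdot> (Sym C A B \<otimes> Id C D)"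
    and Sym_Tens_left: "\<lbrakk>A \<in> Obj C; B \<in> Obj C; D \<in> Obj C\<rbrakk>
      \<Longrightarrow> Sym C (A \<otimes>\<^sub>o B) D = (Sym C A D \<otimes> Id C B) \<cdot> (Id C A \<otimes> Sym C B D)"
    and Sym_Sym: "\<lbrakk>A \<in> Obj C; B \<in> Obj C\<rbrakk>
      \<Longrightarrow> Sym C B A \<cdot> Sym C A B = Id C (A \<otimes>\<^sub>o B)"

definition is_inverse :: "('o, 'm, 'z) monoidal_data_scheme \<Rightarrow> 'm \<Rightarrow> 'm \<Rightarrow> bool" where
  "is_inverse C f g \<longleftrightarrow> f \<in> Arr C \<and> g \<in> Hom C (Cod C f) (Dom C f)
     \<and> Comp C g f = Id C (Dom C f) \<and> Comp C f g = Id C (Cod C f)"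

definition invertible :: "('o, 'm, 'z) monoidal_data_scheme \<Rightarrow> 'm \<Rightarrow> bool" where
  "invertible C f \<longleftrightarrow> (\<exists>g. is_inverse C f g)"

definition Inv :: "('o, 'm, 'z) monoidal_data_scheme \<Rightarrow> 'm \<Rightarrow> 'm" where
  "Inv C f = (THE g. is_inverse C f g)"

primrec tpow :: "('o, 'm, 'z) monoidal_data_scheme \<Rightarrow> 'o \<Rightarrow> nat \<Rightarrow> 'o" where
  "tpow C V 0 = Unit C"
| "tpow C V (Suc n) = Tens_obj C V (tpow C V n)"

text \<open>For \<open>\<phi> : V\<^sup>l \<rightarrow> V\<^sup>r\<close>, the arrow \<open>on_strand C V k \<phi> i\<close> is
  \<open>\<phi>\<^sub>i : V\<^sup>k\<^sup>+\<^sup>l \<rightarrow> V\<^sup>k\<^sup>+\<^sup>r\<close>, meaningful for \<open>1 \<le> i \<le> k + 1\<close>.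
  The number \<open>k\<close> of added identity strands, which is usually left implicit, is an explicit argument.\<close>

definition on_strand ::
    "('o, 'm, 'z) monoidal_data_scheme \<Rightarrow> 'o \<Rightarrow> nat \<Rightarrow> 'm \<Rightarrow> nat \<Rightarrow> 'm" where
  "on_strand C V k \<phi> i =
     Tens C (Id C (tpow C V (i - 1))) (Tens C \<phi> (Id C (tpow C V (k + 1 - i))))"

text \<open>\<open>strand_power C V l r \<phi> n\<close> is \<open>\<phi>\<^sup>n = \<phi>\<^sub>1 \<circ> \<dots> \<circ> \<phi>\<^sub>1\<close> (\<open>n\<close> factors) for \<open>\<phi> : V\<^sup>l \<rightarrow> V\<^sup>r\<close>.
  Consecutive factors carry different numbers of identity strands: they are chosen least possible,
  so that \<open>\<Delta>\<^sup>n : V \<rightarrow> V\<^sup>n\<^sup>+\<^sup>1\<close> and \<open>\<mu>\<^sup>n : V\<^sup>n\<^sup>+\<^sup>1 \<rightarrow> V\<close> for \<open>\<Delta> : V \<rightarrow> V\<^sup>2\<close> and \<open>\<mu> : V\<^sup>2 \<rightarrow> V\<close>.\<close>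

primrec strand_power ::
    "('o, 'm, 'z) monoidal_data_scheme \<Rightarrow> 'o \<Rightarrow> nat \<Rightarrow> nat \<Rightarrow> 'm \<Rightarrow> nat \<Rightarrow> 'm" where
  "strand_power C V l r \<phi> 0 = Id C (tpow C V (min l r))"
| "strand_power C V l r \<phi> (Suc n) =
     (if l \<le> r
      then Comp C (on_strand C V (n * (r - l)) \<phi> 1) (strand_power C V l r \<phi> n)
      else Comp C (strand_power C V l r \<phi> n) (on_strand C V (n * (l - r)) \<phi> 1))"

locale shelf = symmetric_category +
  fixes V \<Delta> lhd
  assumes V_in_Obj: "V \<in> Obj C"
    and Delta_in_Hom: "\<Delta> \<in> Hom C V (V \<otimes>\<^sub>o V)"
    and lhd_in_Hom: "lhd \<in> Hom C (V \<otimes>\<^sub>o V) V"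
    and coassociative: "on_strand C V 1 \<Delta> 1 \<cdot> \<Delta> = on_strand C V 1 \<Delta> 2 \<cdot> \<Delta>"
    and weakly_cocommutative:
      "on_strand C V 2 (Sym C V V) 2 \<cdot> strand_power C V 1 2 \<Delta> 3 = strand_power C V 1 2 \<Delta> 3"
    and self_distributive:
      "strand_power C V 2 1 lhd 2 =
         lhd \<cdot> (lhd \<otimes> lhd) \<cdot> on_strand C V 2 (Sym C V V) 2 \<cdot> on_strand C V 2 \<Delta> 3"
    and Delta_lhd:
      "\<Delta> \<cdot> lhd = (lhd \<otimes> lhd) \<cdot> on_strand C V 2 (Sym C V V) 2 \<cdot> (\<Delta> \<otimes> \<Delta>)"

locale rack = shelf C V \<Delta> lhd
  for C :: "('o, 'm, 'z) monoidal_data_scheme" (structure) and V \<Delta> \<epsilon> lhd lhd' +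
  assumes eps_in_Hom: "\<epsilon> \<in> Hom C V \<I>"
    and lhd'_in_Hom: "lhd' \<in> Hom C (V \<otimes>\<^sub>o V) V"
    and right_counit: "on_strand C V 1 \<epsilon> 2 \<cdot> \<Delta> = Id C V"
    and lhd'_lhd:
      "lhd' \<cdot> on_strand C V 1 lhd 1 \<cdot> on_strand C V 1 (Sym C V V) 2 \<cdot> on_strand C V 1 \<Delta> 2
         = Id C V \<otimes> \<epsilon>"
    and lhd_lhd':
      "lhd \<cdot> on_strand C V 1 lhd' 1 \<cdot> on_strand C V 1 (Sym C V V) 2 \<cdot> on_strand C V 1 \<Delta> 2
         = Id C V \<otimes> \<epsilon>"

locale specific_braiding = strict_monoidal_category +
  fixes V \<sigma>
  assumes V_in_Obj: "V \<in> Obj C"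
    and sigma_in_Hom: "\<sigma> \<in> Hom C (V \<otimes>\<^sub>o V) (V \<otimes>\<^sub>o V)"
    and sigma_invertible: "invertible C \<sigma>"
    and yang_baxter:
      "on_strand C V 1 \<sigma> 1 \<cdot> on_strand C V 1 \<sigma> 2 \<cdot> on_strand C V 1 \<sigma> 1
         = on_strand C V 1 \<sigma> 2 \<cdot> on_strand C V 1 \<sigma> 1 \<cdot> on_strand C V 1 \<sigma> 2"

locale hopf_algebra = symmetric_category +
  fixes H \<mu> \<Delta> \<nu> \<epsilon> S
  assumes H_in_Obj: "H \<in> Obj C"
    and mu_in_Hom: "\<mu> \<in> Hom C (H \<otimes>\<^sub>o H) H"
    and Delta_in_Hom: "\<Delta> \<in> Hom C H (H \<otimes>\<^sub>o H)"
    and nu_in_Hom: "\<nu> \<in> Hom C \<I> H"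
    and eps_in_Hom: "\<epsilon> \<in> Hom C H \<I>"
    and S_in_Hom: "S \<in> Hom C H H"
    and associative: "\<mu> \<cdot> (\<mu> \<otimes> Id C H) = \<mu> \<cdot> (Id C H \<otimes> \<mu>)"
    and left_unit: "\<mu> \<cdot> (\<nu> \<otimes> Id C H) = Id C H"
    and right_unit: "\<mu> \<cdot> (Id C H \<otimes> \<nu>) = Id C H"
    and coassociative: "(\<Delta> \<otimes> Id C H) \<cdot> \<Delta> = (Id C H \<otimes> \<Delta>) \<cdot> \<Delta>"
    and left_counit: "(\<epsilon> \<otimes> Id C H) \<cdot> \<Delta> = Id C H"
    and right_counit: "(Id C H \<otimes> \<epsilon>) \<cdot> \<Delta> = Id C H"
    and Delta_mu: "\<Delta> \<cdot> \<mu> = (\<mu> \<otimes> \<mu>) \<cdot> (Id C H \<otimes> Sym C H H \<otimes> Id C H) \<cdot> (\<Delta> \<otimes> \<Delta>)"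
    and Delta_nu: "\<Delta> \<cdot> \<nu> = \<nu> \<otimes> \<nu>"
    and eps_mu: "\<epsilon> \<cdot> \<mu> = \<epsilon> \<otimes> \<epsilon>"
    and eps_nu: "\<epsilon> \<cdot> \<nu> = Id C \<I>"
    and left_antipode: "\<mu> \<cdot> (S \<otimes> Id C H) \<cdot> \<Delta> = \<nu> \<cdot> \<epsilon>"
    and right_antipode: "\<mu> \<cdot> (Id C H \<otimes> S) \<cdot> \<Delta> = \<nu> \<cdot> \<epsilon>"

locale cocommutative_hopf_algebra = hopf_algebra +
  assumes cocommutative: "Sym C H H \<cdot> \<Delta> = \<Delta>"

definition hopf_lhd ::
    "('o, 'm, 'z) monoidal_data_scheme \<Rightarrow> 'o \<Rightarrow> 'm \<Rightarrow> 'm \<Rightarrow> 'm \<Rightarrow> 'm" where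
  "hopf_lhd C H \<mu> \<Delta> S =
     Comp C (strand_power C H 2 1 \<mu> 2)
       (Comp C (on_strand C H 2 S 1)
         (Comp C (on_strand C H 1 (Sym C H H) 1) (on_strand C H 1 \<Delta> 2)))"

definition hopf_lhd' ::
    "('o, 'm, 'z) monoidal_data_scheme \<Rightarrow> 'o \<Rightarrow> 'm \<Rightarrow> 'm \<Rightarrow> 'm \<Rightarrow> 'm" where
  "hopf_lhd' C H \<mu> \<Delta> S = Comp C (hopf_lhd C H \<mu> \<Delta> S) (on_strand C H 1 (Inv C S) 2)"

end

theory Submission
  imports Defs
begin

text \<open>
  Cocommutative comonoids and comonoid morphisms in a symmetric category form a category with finite
  products: the product is the tensor product, the projections discard a factor by its counit, and
  \<open>(f \<otimes> g) \<cdot> \<delta>\<close> is the morphism with components \<open>f\<close> and \<open>g\<close>. A cocommutative Hopf algebra is a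
  group object there, so for every cocommutative comonoid \<open>X\<close> the comonoid morphisms \<open>X \<rightarrow> H\<close> form a
  group, on which \<open>lhd\<close> acts as the conjugation \<open>(f, g) \<mapsto> g\<inverse> f g\<close> and \<open>lhd'\<close> as its inverse. Evaluated on
  the projections of \<open>H \<otimes> H\<close> and \<open>H \<otimes> H \<otimes> H\<close>, every axiom becomes an identity between words in a group.
\<close>

section \<open>Simplification rules for strict symmetric monoidal categories\<close>

lemma Hom_iff: "f \<in> Hom C A B \<longleftrightarrow> f \<in> Arr C \<and> Dom C f = A \<and> Cod C f = B"
  by (simp add: Hom_def)

context symmetric_category
begin

lemma Dom_Obj [simp]: "f \<in> Arr C \<Longrightarrow> Dom C f \<in> Obj C"
  and Cod_Obj [simp]: "f \<in> Arr C \<Longrightarrow> Cod C f \<in> Obj C"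
  by (rule Dom_in_Obj Cod_in_Obj; assumption)+

lemma Id_simps [simp]:
  "A \<in> Obj C \<Longrightarrow> Id C A \<in> Arr C"
  "A \<in> Obj C \<Longrightarrow> Dom C (Id C A) = A"
  "A \<in> Obj C \<Longrightarrow> Cod C (Id C A) = A"
  using Id_in_Hom by (auto simp: Hom_iff)

text \<open>Typing goes through \<open>Arr\<close>, \<open>Dom\<close> and \<open>Cod\<close> rather
  than \<open>Hom\<close>, so the simplifier can compute the type of a compound arrow and discharge
  composability conditions itself.\<close>

lemma Comp_simps [simp]:
  "\<lbrakk>f \<in> Arr C; g \<in> Arr C; Cod C f = Dom C g\<rbrakk> \<Longrightarrow> g \<cdot> f \<in> Arr C"
  "\<lbrakk>f \<in> Arr C; g \<in> Arr C; Cod C f = Dom C g\<rbrakk> \<Longrightarrow> Dom C (g \<cdot> f) = Dom C f"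
  "\<lbrakk>f \<in> Arr C; g \<in> Arr C; Cod C f = Dom C g\<rbrakk> \<Longrightarrow> Cod C (g \<cdot> f) = Cod C g"
  using Comp_in_Hom[of f _ _ g] by (auto simp: Hom_iff)

lemma Comp_Id_simps [simp]:
  "\<lbrakk>f \<in> Arr C; Cod C f = A\<rbrakk> \<Longrightarrow> Id C A \<cdot> f = f"
  "\<lbrakk>f \<in> Arr C; Dom C f = A\<rbrakk> \<Longrightarrow> f \<cdot> Id C A = f"
  using Comp_Id_left Comp_Id_right by (auto simp: Hom_iff)

lemma Comp_assoc' [simp]:
  "\<lbrakk>f \<in> Arr C; g \<in> Arr C; h \<in> Arr C; Cod C f = Dom C g; Cod C g = Dom C h\<rbrakk>
    \<Longrightarrow> (h \<cdot> g) \<cdot> f = h \<cdot> g \<cdot> f"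
  using Comp_assoc by (auto simp: Hom_iff)

lemma Tens_obj_simps [simp]:
  "\<I> \<in> Obj C"
  "\<lbrakk>A \<in> Obj C; B \<in> Obj C\<rbrakk> \<Longrightarrow> A \<otimes>\<^sub>o B \<in> Obj C"
  "\<lbrakk>A \<in> Obj C; B \<in> Obj C; D \<in> Obj C\<rbrakk> \<Longrightarrow> (A \<otimes>\<^sub>o B) \<otimes>\<^sub>o D = A \<otimes>\<^sub>o B \<otimes>\<^sub>o D"
  "A \<in> Obj C \<Longrightarrow> \<I> \<otimes>\<^sub>o A = A"
  "A \<in> Obj C \<Longrightarrow> A \<otimes>\<^sub>o \<I> = A"
  by (auto intro: Unit_in_Obj Tens_obj_in_Obj Tens_obj_assoc Tens_obj_Unit_left Tens_obj_Unit_right)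

lemma Tens_simps [simp]:
  "\<lbrakk>f \<in> Arr C; g \<in> Arr C\<rbrakk> \<Longrightarrow> f \<otimes> g \<in> Arr C"
  "\<lbrakk>f \<in> Arr C; g \<in> Arr C\<rbrakk> \<Longrightarrow> Dom C (f \<otimes> g) = Dom C f \<otimes>\<^sub>o Dom C g"
  "\<lbrakk>f \<in> Arr C; g \<in> Arr C\<rbrakk> \<Longrightarrow> Cod C (f \<otimes> g) = Cod C f \<otimes>\<^sub>o Cod C g"
  "\<lbrakk>f \<in> Arr C; g \<in> Arr C; h \<in> Arr C\<rbrakk> \<Longrightarrow> (f \<otimes> g) \<otimes> h = f \<otimes> g \<otimes> h"
  "f \<in> Arr C \<Longrightarrow> Id C \<I> \<otimes> f = f"
  "f \<in> Arr C \<Longrightarrow> f \<otimes> Id C \<I> = f"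
  "\<lbrakk>A \<in> Obj C; B \<in> Obj C\<rbrakk> \<Longrightarrow> Id C A \<otimes> Id C B = Id C (A \<otimes>\<^sub>o B)"
  using Tens_in_Hom[of f _ _ g] Tens_assoc Tens_Unit_left Tens_Unit_right Tens_Id
  by (auto simp: Hom_iff)

text \<open>In a right-nested tensor the two identities do not form a subterm of their own, so the
  merging rule in \<open>Tens_simps\<close> cannot reach them.\<close>

lemma Tens_Id_Id: "\<lbrakk>A \<in> Obj C; B \<in> Obj C; f \<in> Arr C\<rbrakk> \<Longrightarrow> Id C A \<otimes> Id C B \<otimes> f = Id C (A \<otimes>\<^sub>o B) \<otimes> f"
  using Tens_simps(4)[of "Id C A" "Id C B" f] by simp

lemma interchange':
  "\<lbrakk>f \<in> Arr C; g \<in> Arr C; f' \<in> Arr C; g' \<in> Arr C; Cod C f = Dom C g; Cod C f' = Dom C g'\<rbrakk>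
    \<Longrightarrow> (g \<otimes> g') \<cdot> (f \<otimes> f') = (g \<cdot> f) \<otimes> (g' \<cdot> f')"
  using interchange by (auto simp: Hom_iff)

lemma Sym_simps [simp]:
  "\<lbrakk>A \<in> Obj C; B \<in> Obj C\<rbrakk> \<Longrightarrow> Sym C A B \<in> Arr C"
  "\<lbrakk>A \<in> Obj C; B \<in> Obj C\<rbrakk> \<Longrightarrow> Dom C (Sym C A B) = A \<otimes>\<^sub>o B"
  "\<lbrakk>A \<in> Obj C; B \<in> Obj C\<rbrakk> \<Longrightarrow> Cod C (Sym C A B) = B \<otimes>\<^sub>o A"
  "\<lbrakk>A \<in> Obj C; B \<in> Obj C\<rbrakk> \<Longrightarrow> Sym C B A \<cdot> Sym C A B = Id C (A \<otimes>\<^sub>o B)"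
  using Sym_in_Hom Sym_Sym by (auto simp: Hom_iff)

lemma Sym_natural':
  "\<lbrakk>f \<in> Arr C; g \<in> Arr C; Cod C f = B; Cod C g = B'\<rbrakk>
    \<Longrightarrow> Sym C B B' \<cdot> (f \<otimes> g) = (g \<otimes> f) \<cdot> Sym C (Dom C f) (Dom C g)"
  using Sym_natural by (auto simp: Hom_iff)

text \<open>The hexagon law for the unit object tensored with itself makes this arrow idempotent,
  and an invertible idempotent is an identity.\<close>

lemma Sym_Unit_right [simp]:
  assumes A: "A \<in> Obj C"
  shows "Sym C A \<I> = Id C A"
proof -
  have "Sym C A \<I> = Sym C A (\<I> \<otimes>\<^sub>o \<I>)"
    by simp
  also have "\<dots> = (Id C \<I> \<otimes> Sym C A \<I>) \<cdot> (Sym C A \<I> \<otimes> Id C \<I>)"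
    using A by (intro Sym_Tens_right Tens_obj_simps)
  also have "\<dots> = Sym C A \<I> \<cdot> Sym C A \<I>"
    using A by simp
  finally have "Sym C \<I> A \<cdot> Sym C A \<I> = Sym C \<I> A \<cdot> Sym C A \<I> \<cdot> Sym C A \<I>"
    by (rule arg_cong[where f = "Comp C (Sym C \<I> A)"])
  also have "\<dots> = (Sym C \<I> A \<cdot> Sym C A \<I>) \<cdot> Sym C A \<I>"
    using A by (simp del: Sym_simps(4))
  finally show ?thesis
    using A by simp
qed

lemma Sym_Unit_left [simp]:
  assumes "A \<in> Obj C"
  shows "Sym C \<I> A = Id C A"
  using Sym_simps(4)[of A \<I>] assms by simp

end

section \<open>Cocommutative comonoids\<close>

context symmetric_category
begin

definition pairing :: "'b \<Rightarrow> 'b \<Rightarrow> 'b \<Rightarrow> 'b" where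
  "pairing \<delta> f g = (f \<otimes> g) \<cdot> \<delta>"

text \<open>Only the left counit law is listed; cocommutativity turns it into the right one in
  \<open>comult_counit_right\<close>.\<close>

definition cocomm_comonoid :: "'a \<Rightarrow> 'b \<Rightarrow> 'b \<Rightarrow> bool" where
  "cocomm_comonoid X \<delta> e \<longleftrightarrow> X \<in> Obj C
    \<and> \<delta> \<in> Arr C \<and> Dom C \<delta> = X \<and> Cod C \<delta> = X \<otimes>\<^sub>o X
    \<and> e \<in> Arr C \<and> Dom C e = X \<and> Cod C e = \<I>
    \<and> (\<delta> \<otimes> Id C X) \<cdot> \<delta> = (Id C X \<otimes> \<delta>) \<cdot> \<delta>
    \<and> (e \<otimes> Id C X) \<cdot> \<delta> = Id C X
    \<and> Sym C X X \<cdot> \<delta> = \<delta>"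

definition comonoid_hom :: "'a \<Rightarrow> 'b \<Rightarrow> 'b \<Rightarrow> 'a \<Rightarrow> 'b \<Rightarrow> 'b \<Rightarrow> 'b \<Rightarrow> bool" where
  "comonoid_hom X \<delta> e Y \<delta>' e' f \<longleftrightarrow> f \<in> Arr C \<and> Dom C f = X \<and> Cod C f = Y
    \<and> \<delta>' \<cdot> f = (f \<otimes> f) \<cdot> \<delta> \<and> e' \<cdot> f = e"

text \<open>On elements this is (x, y) \<mapsto> (x, y, x, y): each factor is copied, then the two
  middle copies change places.\<close>

definition tensor_comult :: "'a \<Rightarrow> 'b \<Rightarrow> 'a \<Rightarrow> 'b \<Rightarrow> 'b" where
  "tensor_comult X \<delta> Y \<delta>' = (Id C X \<otimes> Sym C X Y \<otimes> Id C Y) \<cdot> (\<delta> \<otimes> \<delta>')"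

lemma comonoid_hom_simps:
  "comonoid_hom X \<delta> e Y \<delta>' e' f \<Longrightarrow> f \<in> Arr C"
  "comonoid_hom X \<delta> e Y \<delta>' e' f \<Longrightarrow> Dom C f = X"
  "comonoid_hom X \<delta> e Y \<delta>' e' f \<Longrightarrow> Cod C f = Y"
  "comonoid_hom X \<delta> e Y \<delta>' e' f \<Longrightarrow> \<delta>' \<cdot> f = (f \<otimes> f) \<cdot> \<delta>"
  "comonoid_hom X \<delta> e Y \<delta>' e' f \<Longrightarrow> e' \<cdot> f = e"
  by (simp_all add: comonoid_hom_def)

lemma comonoid_hom_Comp:
  assumes X: "cocomm_comonoid X \<delta> e" and Y: "cocomm_comonoid Y \<delta>' e'"
    and Z: "cocomm_comonoid Z \<delta>'' e''"
    and f: "comonoid_hom X \<delta> e Y \<delta>' e' f" and g: "comonoid_hom Y \<delta>' e' Z \<delta>'' e'' g"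
  shows "comonoid_hom X \<delta> e Z \<delta>'' e'' (g \<cdot> f)"
proof -
  note [simp] = comonoid_hom_simps(1-3)[OF f] comonoid_hom_simps(1-3)[OF g]
  have [simp]: "\<delta> \<in> Arr C" "Dom C \<delta> = X" "Cod C \<delta> = X \<otimes>\<^sub>o X"
    "\<delta>' \<in> Arr C" "Dom C \<delta>' = Y" "Cod C \<delta>' = Y \<otimes>\<^sub>o Y"
    "\<delta>'' \<in> Arr C" "Dom C \<delta>'' = Z" "e'' \<in> Arr C" "Dom C e'' = Z"
    using X Y Z by (auto simp: cocomm_comonoid_def)
  have "\<delta>'' \<cdot> g \<cdot> f = (\<delta>'' \<cdot> g) \<cdot> f"
    by simp
  also have "\<dots> = (g \<otimes> g) \<cdot> \<delta>' \<cdot> f"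
    unfolding comonoid_hom_simps(4)[OF g] by simp
  also have "\<dots> = ((g \<otimes> g) \<cdot> (f \<otimes> f)) \<cdot> \<delta>"
    unfolding comonoid_hom_simps(4)[OF f] by simp
  also have "(g \<otimes> g) \<cdot> (f \<otimes> f) = (g \<cdot> f) \<otimes> (g \<cdot> f)"
    by (rule interchange') simp_all
  finally have 1: "\<delta>'' \<cdot> g \<cdot> f = ((g \<cdot> f) \<otimes> (g \<cdot> f)) \<cdot> \<delta>" .
  have "e'' \<cdot> g \<cdot> f = (e'' \<cdot> g) \<cdot> f"
    by simp
  then show ?thesis
    using 1 comonoid_hom_simps(5)[OF f] comonoid_hom_simps(5)[OF g] by (simp add: comonoid_hom_def)
qed

text \<open>Insert \<open>(g \<otimes> g) \<cdot> (f \<otimes> f)\<close>, an identity, in front of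
  \<open>\<delta> \<cdot> g\<close>, and move \<open>f\<close> through the comultiplication, where
  it meets \<open>g\<close> and cancels.\<close>

lemma comonoid_hom_inverse:
  assumes X: "cocomm_comonoid X \<delta> e" and Y: "cocomm_comonoid Y \<delta>' e'"
    and f: "comonoid_hom X \<delta> e Y \<delta>' e' f"
    and [simp]: "g \<in> Arr C" "Dom C g = Y" "Cod C g = X" and fg: "f \<cdot> g = Id C Y" and gf: "g \<cdot> f = Id C X"
  shows "comonoid_hom Y \<delta>' e' X \<delta> e g"
proof -
  note [simp] = comonoid_hom_simps(1-3)[OF f]
  have [simp]: "\<delta> \<in> Arr C" "Dom C \<delta> = X" "Cod C \<delta> = X \<otimes>\<^sub>o X" "e \<in> Arr C" "Dom C e = X"
    "\<delta>' \<in> Arr C" "Dom C \<delta>' = Y" "Cod C \<delta>' = Y \<otimes>\<^sub>o Y" "e' \<in> Arr C" "Dom C e' = Y"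
    "X \<in> Obj C" "Y \<in> Obj C"
    using X Y by (auto simp: cocomm_comonoid_def)
  have "\<delta> \<cdot> g = ((g \<otimes> g) \<cdot> (f \<otimes> f)) \<cdot> \<delta> \<cdot> g"
    using interchange'[of f g f g] by (simp add: gf)
  also have "\<dots> = (g \<otimes> g) \<cdot> ((f \<otimes> f) \<cdot> \<delta>) \<cdot> g"
    by simp
  also have "\<dots> = (g \<otimes> g) \<cdot> \<delta>' \<cdot> f \<cdot> g"
    unfolding comonoid_hom_simps(4)[OF f, symmetric] by simp
  finally have 1: "\<delta> \<cdot> g = (g \<otimes> g) \<cdot> \<delta>'"
    by (simp add: fg)
  have "e \<cdot> g = (e' \<cdot> f) \<cdot> g"
    by (simp only: comonoid_hom_simps(5)[OF f])
  then have "e \<cdot> g = e'"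
    by (simp add: fg)
  then show ?thesis
    using 1 by (simp add: comonoid_hom_def)
qed

end

locale cocommutative_comonoid = symmetric_category +
  fixes X \<delta> e
  assumes comonoid: "cocomm_comonoid X \<delta> e"
begin

lemma comonoid_simps [simp]:
  "X \<in> Obj C" "\<delta> \<in> Arr C" "Dom C \<delta> = X" "Cod C \<delta> = X \<otimes>\<^sub>o X"
  "e \<in> Arr C" "Dom C e = X" "Cod C e = \<I>"
  using comonoid unfolding cocomm_comonoid_def by auto

lemma comult_coassoc: "(\<delta> \<otimes> Id C X) \<cdot> \<delta> = (Id C X \<otimes> \<delta>) \<cdot> \<delta>"
  and comult_counit_left: "(e \<otimes> Id C X) \<cdot> \<delta> = Id C X"
  and comult_cocomm: "Sym C X X \<cdot> \<delta> = \<delta>"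
  using comonoid unfolding cocomm_comonoid_def by auto

lemma comult_counit_right: "(Id C X \<otimes> e) \<cdot> \<delta> = Id C X"
proof -
  have "(Id C X \<otimes> e) \<cdot> \<delta> = (Id C X \<otimes> e) \<cdot> Sym C X X \<cdot> \<delta>"
    by (simp add: comult_cocomm)
  also have "\<dots> = ((Id C X \<otimes> e) \<cdot> Sym C X X) \<cdot> \<delta>"
    by simp
  also have "(Id C X \<otimes> e) \<cdot> Sym C X X = e \<otimes> Id C X"
    using Sym_natural'[of e "Id C X" \<I> X] by simp
  finally show ?thesis
    by (simp add: comult_counit_left)
qed

abbreviation pr (infixr "\<triangle>" 55) where "f \<triangle> g \<equiv> pairing \<delta> f g"

lemma pairing_simps [simp]:
  "\<lbrakk>f \<in> Arr C; Dom C f = X; g \<in> Arr C; Dom C g = X\<rbrakk> \<Longrightarrow> f \<triangle> g \<in> Arr C"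
  "\<lbrakk>f \<in> Arr C; Dom C f = X; g \<in> Arr C; Dom C g = X\<rbrakk> \<Longrightarrow> Dom C (f \<triangle> g) = X"
  "\<lbrakk>f \<in> Arr C; Dom C f = X; g \<in> Arr C; Dom C g = X\<rbrakk>
    \<Longrightarrow> Cod C (f \<triangle> g) = Cod C f \<otimes>\<^sub>o Cod C g"
  by (simp_all add: pairing_def)

lemma Tens_pairing [simp]:
  "\<lbrakk>f \<in> Arr C; Dom C f = X; g \<in> Arr C; Dom C g = X; a \<in> Arr C; b \<in> Arr C;
    Dom C a = Cod C f; Dom C b = Cod C g\<rbrakk> \<Longrightarrow> (a \<otimes> b) \<cdot> (f \<triangle> g) = (a \<cdot> f) \<triangle> (b \<cdot> g)"
  by (simp add: pairing_def interchange' flip: Comp_assoc')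

lemma pairing_assoc [simp]:
  assumes "f \<in> Arr C" "Dom C f = X" "g \<in> Arr C" "Dom C g = X" "h \<in> Arr C" "Dom C h = X"
  shows "(f \<triangle> g) \<triangle> h = f \<triangle> g \<triangle> h"
proof -
  have "(f \<triangle> g) \<triangle> h = ((f \<otimes> g \<otimes> h) \<cdot> (\<delta> \<otimes> Id C X)) \<cdot> \<delta>"
    using assms interchange'[of \<delta> "f \<otimes> g" "Id C X" h] by (simp add: pairing_def)
  also have "\<dots> = (f \<otimes> g \<otimes> h) \<cdot> (\<delta> \<otimes> Id C X) \<cdot> \<delta>"
    using assms by simp
  also have "\<dots> = ((f \<otimes> g \<otimes> h) \<cdot> (Id C X \<otimes> \<delta>)) \<cdot> \<delta>"
    using assms by (simp add: comult_coassoc)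
  also have "\<dots> = f \<triangle> g \<triangle> h"
    using assms by (simp add: pairing_def interchange')
  finally show ?thesis .
qed

text \<open>Tuples are kept nested to the right by \<open>pairing_assoc\<close>. An arrow
  \<open>a\<close> that consumes the first two components therefore needs this rebracketed form of
  \<open>Tens_pairing\<close>.\<close>

lemma Tens_pairing_pairing [simp]:
  assumes "f \<in> Arr C" "Dom C f = X" "g \<in> Arr C" "Dom C g = X" "h \<in> Arr C" "Dom C h = X"
    "a \<in> Arr C" "b \<in> Arr C" "Dom C a = Cod C f \<otimes>\<^sub>o Cod C g" "Dom C b = Cod C h"
  shows "(a \<otimes> b) \<cdot> (f \<triangle> g \<triangle> h) = (a \<cdot> (f \<triangle> g)) \<triangle> (b \<cdot> h)"
proof -
  have "(a \<otimes> b) \<cdot> (f \<triangle> g \<triangle> h) = (a \<otimes> b) \<cdot> ((f \<triangle> g) \<triangle> h)"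
    by (simp only: pairing_assoc assms)
  also have "\<dots> = (a \<cdot> (f \<triangle> g)) \<triangle> (b \<cdot> h)"
    by (rule Tens_pairing) (simp_all add: assms)
  finally show ?thesis .
qed

text \<open>Naturality moves the symmetry next to \<open>\<delta>\<close>, where cocommutativity
  absorbs it.\<close>

lemma Sym_pairing [simp]:
  assumes "f \<in> Arr C" "Dom C f = X" "g \<in> Arr C" "Dom C g = X" "Cod C f = A" "Cod C g = B"
  shows "Sym C A B \<cdot> (f \<triangle> g) = g \<triangle> f"
proof -
  have "A \<in> Obj C" "B \<in> Obj C"
    using assms Cod_Obj by blast+
  note assms = assms this
  have "Sym C A B \<cdot> (f \<triangle> g) = (Sym C A B \<cdot> (f \<otimes> g)) \<cdot> \<delta>"
    using assms by (simp add: pairing_def)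
  also have "\<dots> = (g \<otimes> f) \<cdot> Sym C X X \<cdot> \<delta>"
    using assms by (subst Sym_natural') auto
  finally show ?thesis
    by (simp add: comult_cocomm pairing_def)
qed

lemma pairing_counit [simp]:
  assumes "f \<in> Arr C" "Dom C f = X"
  shows "f \<triangle> e = f" and "e \<triangle> f = f"
proof -
  have "f \<triangle> e = ((f \<otimes> Id C \<I>) \<cdot> (Id C X \<otimes> e)) \<cdot> \<delta>"
    using assms by (subst interchange') (simp_all add: pairing_def)
  also have "\<dots> = f"
    using assms by (simp add: comult_counit_right)
  finally show "f \<triangle> e = f" .
  have "e \<triangle> f = ((Id C \<I> \<otimes> f) \<cdot> (e \<otimes> Id C X)) \<cdot> \<delta>"
    using assms by (subst interchange') (simp_all add: pairing_def)
  also have "\<dots> = f"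
    using assms by (simp add: comult_counit_left)
  finally show "e \<triangle> f = f" .
qed

lemma comult_hom: "comonoid_hom X \<delta> e Y \<delta>1 e1 f \<Longrightarrow> \<delta>1 \<cdot> f = f \<triangle> f"
  by (simp add: comonoid_hom_def pairing_def)

text \<open>Composition on this side requires \<open>k\<close> to commute with the
  comultiplications. It serves to build the projections of a threefold product from those of a
  twofold one.\<close>

lemma pairing_Comp_hom:
  assumes "comonoid_hom Y \<delta>1 e1 X \<delta> e k" "cocomm_comonoid Y \<delta>1 e1"
    "f \<in> Arr C" "Dom C f = X" "g \<in> Arr C" "Dom C g = X"
  shows "(f \<triangle> g) \<cdot> k = pairing \<delta>1 (f \<cdot> k) (g \<cdot> k)"
proof -
  have [simp]: "k \<in> Arr C" "Dom C k = Y" "Cod C k = X" "\<delta>1 \<in> Arr C" "Cod C \<delta>1 = Y \<otimes>\<^sub>o Y"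
    and k: "\<delta> \<cdot> k = (k \<otimes> k) \<cdot> \<delta>1"
    using assms by (auto simp: comonoid_hom_def cocomm_comonoid_def)
  have "(f \<triangle> g) \<cdot> k = ((f \<otimes> g) \<cdot> (k \<otimes> k)) \<cdot> \<delta>1"
    using assms(3-) by (simp add: pairing_def k)
  then show ?thesis
    using assms(3-) by (simp add: pairing_def interchange')
qed

text \<open>Both ways around give the tuple with components \<open>f\<close>, \<open>g\<close>,
  \<open>f\<close>, \<open>g\<close>: copying yields \<open>f\<close>, \<open>f\<close>,
  \<open>g\<close>, \<open>g\<close>, and the swap in \<open>tensor_comult\<close> exchanges the
  middle two.\<close>

lemma comonoid_hom_pairing:
  assumes f: "comonoid_hom X \<delta> e Y \<delta>1 e1 f" and g: "comonoid_hom X \<delta> e Z \<delta>2 e2 g"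
    and Y: "cocomm_comonoid Y \<delta>1 e1" and Z: "cocomm_comonoid Z \<delta>2 e2"
  shows "comonoid_hom X \<delta> e (Y \<otimes>\<^sub>o Z) (tensor_comult Y \<delta>1 Z \<delta>2) (e1 \<otimes> e2) (f \<triangle> g)"
proof -
  have [simp]: "f \<in> Arr C" "Dom C f = X" "Cod C f = Y" "e1 \<cdot> f = e"
    "g \<in> Arr C" "Dom C g = X" "Cod C g = Z" "e2 \<cdot> g = e"
    using f g by (auto simp: comonoid_hom_def)
  have [simp]: "\<delta>1 \<in> Arr C" "Dom C \<delta>1 = Y" "Cod C \<delta>1 = Y \<otimes>\<^sub>o Y" "e1 \<in> Arr C" "Dom C e1 = Y" "Y \<in> Obj C"
    "\<delta>2 \<in> Arr C" "Dom C \<delta>2 = Z" "Cod C \<delta>2 = Z \<otimes>\<^sub>o Z" "e2 \<in> Arr C" "Dom C e2 = Z" "Z \<in> Obj C"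
    "Cod C e1 = \<I>" "Cod C e2 = \<I>"
    using Y Z by (auto simp: cocomm_comonoid_def)
  have "tensor_comult Y \<delta>1 Z \<delta>2 \<cdot> (f \<triangle> g) = (f \<triangle> g) \<triangle> f \<triangle> g"
    by (simp add: tensor_comult_def comult_hom[OF f] comult_hom[OF g])
  also have "\<dots> = ((f \<triangle> g) \<otimes> (f \<triangle> g)) \<cdot> \<delta>"
    by (simp only: pairing_def)
  finally show ?thesis
    by (simp add: comonoid_hom_def)
qed

end

section \<open>Products of cocommutative comonoids\<close>

locale two_cocommutative_comonoids =
  A: cocommutative_comonoid C X \<delta> e + B: cocommutative_comonoid C Y \<delta>' e'
  for C (structure) and X \<delta> e Y \<delta>' e'
begin

abbreviation "D \<equiv> A.tensor_comult X \<delta> Y \<delta>'"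

lemma D_simps [simp]: "D \<in> Arr C" "Dom C D = X \<otimes>\<^sub>o Y" "Cod C D = X \<otimes>\<^sub>o Y \<otimes>\<^sub>o X \<otimes>\<^sub>o Y"
  by (simp_all add: A.tensor_comult_def)

text \<open>Naturality pulls the swap to the left past the inner arrows, so that each
  comultiplication meets only arrows on its own comonoid. When an inner arrow is a counit, the
  remaining symmetry is an identity.\<close>

lemma Tens_tensor_comult:
  assumes [simp]: "f \<in> Arr C" "Dom C f = X" "g \<in> Arr C" "Dom C g = Y"
    "h \<in> Arr C" "Dom C h = X" "k \<in> Arr C" "Dom C k = Y"
  shows "(f \<otimes> g \<otimes> h \<otimes> k) \<cdot> D =
    (Id C (Cod C f) \<otimes> Sym C (Cod C h) (Cod C g) \<otimes> Id C (Cod C k)) \<cdot>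
      (((f \<otimes> h) \<cdot> \<delta>) \<otimes> ((g \<otimes> k) \<cdot> \<delta>'))"
proof -
  have "(f \<otimes> g \<otimes> h \<otimes> k) \<cdot> (Id C X \<otimes> Sym C X Y \<otimes> Id C Y)
      = f \<otimes> ((g \<otimes> h) \<cdot> Sym C X Y) \<otimes> k"
    using A.interchange'[of "Id C X" f "Sym C X Y \<otimes> Id C Y" "g \<otimes> h \<otimes> k"]
      A.interchange'[of "Sym C X Y" "g \<otimes> h" "Id C Y" k] by simp
  also have "(g \<otimes> h) \<cdot> Sym C X Y = Sym C (Cod C h) (Cod C g) \<cdot> (h \<otimes> g)"
    using A.Sym_natural'[of h g] by simp
  also have "f \<otimes> (Sym C (Cod C h) (Cod C g) \<cdot> (h \<otimes> g)) \<otimes> k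
      = (Id C (Cod C f) \<otimes> Sym C (Cod C h) (Cod C g) \<otimes> Id C (Cod C k)) \<cdot> (f \<otimes> h \<otimes> g \<otimes> k)"
    using A.interchange'[of f "Id C (Cod C f)" "h \<otimes> g \<otimes> k" "Sym C (Cod C h) (Cod C g) \<otimes> Id C (Cod C k)"]
      A.interchange'[of "h \<otimes> g" "Sym C (Cod C h) (Cod C g)" k "Id C (Cod C k)"] by simp
  finally have *: "(f \<otimes> g \<otimes> h \<otimes> k) \<cdot> (Id C X \<otimes> Sym C X Y \<otimes> Id C Y)
    = (Id C (Cod C f) \<otimes> Sym C (Cod C h) (Cod C g) \<otimes> Id C (Cod C k)) \<cdot> (f \<otimes> h \<otimes> g \<otimes> k)" .
  have "(f \<otimes> g \<otimes> h \<otimes> k) \<cdot> D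
    = ((f \<otimes> g \<otimes> h \<otimes> k) \<cdot> (Id C X \<otimes> Sym C X Y \<otimes> Id C Y)) \<cdot> (\<delta> \<otimes> \<delta>')"
    by (simp add: A.tensor_comult_def)
  also have "\<dots> = (Id C (Cod C f) \<otimes> Sym C (Cod C h) (Cod C g) \<otimes> Id C (Cod C k)) \<cdot>
      (((f \<otimes> h) \<otimes> (g \<otimes> k)) \<cdot> (\<delta> \<otimes> \<delta>'))"
    unfolding * by simp
  also have "((f \<otimes> h) \<otimes> (g \<otimes> k)) \<cdot> (\<delta> \<otimes> \<delta>') = ((f \<otimes> h) \<cdot> \<delta>) \<otimes> ((g \<otimes> k) \<cdot> \<delta>')"
    by (rule A.interchange') simp_all
  finally show ?thesis .
qed

lemma tensor_comult_cocomm: "Sym C (X \<otimes>\<^sub>o Y) (X \<otimes>\<^sub>o Y) \<cdot> D = D"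
proof -
  let ?c = "Id C X \<otimes> Sym C X Y \<otimes> Id C Y"
  \<comment> \<open>The hexagon laws split the symmetry of \<open>X \<otimes>\<^sub>o Y\<close> with
    itself into four crossings. The crossing of \<open>Y\<close> with \<open>X\<close> undoes
    \<open>?c\<close>, the crossing of \<open>X\<close> with \<open>Y\<close> recreates it, and two
    self-crossings remain.\<close>
  have 1: "(Sym C Y (X \<otimes>\<^sub>o Y)) \<cdot> (Sym C X Y \<otimes> Id C Y) = Id C X \<otimes> Sym C Y Y"
    using A.Sym_Tens_right[of Y X Y] A.interchange'[of "Sym C X Y" "Sym C Y X" "Id C Y" "Id C Y"]
    by simp
  have 2: "Sym C X (X \<otimes>\<^sub>o Y) = (Id C X \<otimes> Sym C X Y) \<cdot> (Sym C X X \<otimes> Id C Y)"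
    by (rule A.Sym_Tens_right) simp_all
  have "Sym C (X \<otimes>\<^sub>o Y) (X \<otimes>\<^sub>o Y) \<cdot> ?c
      = (Sym C X (X \<otimes>\<^sub>o Y) \<otimes> Id C Y) \<cdot> (Id C X \<otimes> Sym C Y (X \<otimes>\<^sub>o Y)) \<cdot> ?c"
    using A.Sym_Tens_left[of X Y "X \<otimes>\<^sub>o Y"] by simp
  also have "(Id C X \<otimes> Sym C Y (X \<otimes>\<^sub>o Y)) \<cdot> ?c = Id C X \<otimes> Id C X \<otimes> Sym C Y Y"
    by (subst A.interchange') (simp_all add: 1)
  also have "Sym C X (X \<otimes>\<^sub>o Y) \<otimes> Id C Y = ?c \<cdot> (Sym C X X \<otimes> Id C Y \<otimes> Id C Y)"
    using A.interchange'[of "Sym C X X \<otimes> Id C Y" "Id C X \<otimes> Sym C X Y" "Id C Y" "Id C Y"]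
    by (simp add: 2)
  also have "(?c \<cdot> (Sym C X X \<otimes> Id C Y \<otimes> Id C Y)) \<cdot> (Id C X \<otimes> Id C X \<otimes> Sym C Y Y)
      = ?c \<cdot> (Sym C X X \<otimes> Sym C Y Y)"
    using A.interchange'[of "Id C (X \<otimes>\<^sub>o X)" "Sym C X X" "Sym C Y Y" "Id C (Y \<otimes>\<^sub>o Y)"]
    by (simp add: A.Tens_Id_Id)
  finally have 3: "Sym C (X \<otimes>\<^sub>o Y) (X \<otimes>\<^sub>o Y) \<cdot> ?c = ?c \<cdot> (Sym C X X \<otimes> Sym C Y Y)" .
  have "Sym C (X \<otimes>\<^sub>o Y) (X \<otimes>\<^sub>o Y) \<cdot> D = (Sym C (X \<otimes>\<^sub>o Y) (X \<otimes>\<^sub>o Y) \<cdot> ?c) \<cdot> (\<delta> \<otimes> \<delta>')"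
    by (simp add: A.tensor_comult_def)
  also have "\<dots> = ?c \<cdot> ((Sym C X X \<otimes> Sym C Y Y) \<cdot> (\<delta> \<otimes> \<delta>'))"
    unfolding 3 by simp
  also have "\<dots> = D"
    by (simp add: A.interchange' A.comult_cocomm B.comult_cocomm A.tensor_comult_def)
  finally show ?thesis .
qed

lemma tensor_comult_coassoc:
  "(D \<otimes> Id C (X \<otimes>\<^sub>o Y)) \<cdot> D = (Id C (X \<otimes>\<^sub>o Y) \<otimes> D) \<cdot> D"
proof -
  let ?c = "Sym C X Y"
  let ?Q = "((\<delta> \<otimes> Id C X) \<cdot> \<delta>) \<otimes> ((\<delta>' \<otimes> Id C Y) \<cdot> \<delta>')"
  \<comment> \<open>Both iterated comultiplications are a permutation after \<open>?Q\<close> that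
    fixes the outermost factors. On the inner four, each side first crosses the second
    \<open>X\<close> with the first \<open>Y\<close>; two disjoint crossings follow, whose order is
    immaterial.\<close>
  have inner: "(?c \<otimes> Id C Y \<otimes> Id C X) \<cdot> (Id C X \<otimes> Sym C X (Y \<otimes>\<^sub>o Y))
      = (Id C Y \<otimes> Id C X \<otimes> ?c) \<cdot> (Sym C (X \<otimes>\<^sub>o X) Y \<otimes> Id C Y)"
  proof -
    have 1: "Id C X \<otimes> Sym C X (Y \<otimes>\<^sub>o Y) = (Id C (X \<otimes>\<^sub>o Y) \<otimes> ?c) \<cdot> (Id C X \<otimes> ?c \<otimes> Id C Y)"
      using A.interchange'[of "Id C X" "Id C X" "?c \<otimes> Id C Y" "Id C Y \<otimes> ?c"]
        A.Sym_Tens_right[of X Y Y] by (simp add: A.Tens_Id_Id)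
    have 2: "Sym C (X \<otimes>\<^sub>o X) Y \<otimes> Id C Y = (?c \<otimes> Id C (X \<otimes>\<^sub>o Y)) \<cdot> (Id C X \<otimes> ?c \<otimes> Id C Y)"
      using A.interchange'[of "Id C X \<otimes> ?c" "?c \<otimes> Id C X" "Id C Y" "Id C Y"]
        A.Sym_Tens_left[of X X Y] by simp
    have "(?c \<otimes> Id C (Y \<otimes>\<^sub>o X)) \<cdot> (Id C (X \<otimes>\<^sub>o Y) \<otimes> ?c) = (Id C (Y \<otimes>\<^sub>o X) \<otimes> ?c) \<cdot> (?c \<otimes> Id C (X \<otimes>\<^sub>o Y))"
      by (simp add: A.interchange')
    then have "((?c \<otimes> Id C (Y \<otimes>\<^sub>o X)) \<cdot> (Id C (X \<otimes>\<^sub>o Y) \<otimes> ?c)) \<cdot> (Id C X \<otimes> ?c \<otimes> Id C Y)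
       = ((Id C (Y \<otimes>\<^sub>o X) \<otimes> ?c) \<cdot> (?c \<otimes> Id C (X \<otimes>\<^sub>o Y))) \<cdot> (Id C X \<otimes> ?c \<otimes> Id C Y)"
      by (rule arg_cong)
    then show ?thesis
      by (simp add: 1 2 A.Tens_Id_Id)
  qed
  have "(D \<otimes> Id C (X \<otimes>\<^sub>o Y)) \<cdot> D
      = ((Id C X \<otimes> ?c \<otimes> Id C Y) \<otimes> Id C (X \<otimes>\<^sub>o Y)) \<cdot> ((\<delta> \<otimes> \<delta>' \<otimes> Id C X \<otimes> Id C Y) \<cdot> D)"
    using A.interchange'[of "\<delta> \<otimes> \<delta>'" "Id C X \<otimes> ?c \<otimes> Id C Y" "Id C (X \<otimes>\<^sub>o Y)" "Id C (X \<otimes>\<^sub>o Y)"]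
    by (simp add: A.tensor_comult_def flip: A.Comp_assoc')
  also have "(\<delta> \<otimes> \<delta>' \<otimes> Id C X \<otimes> Id C Y) \<cdot> D = (Id C (X \<otimes>\<^sub>o X) \<otimes> Sym C X (Y \<otimes>\<^sub>o Y) \<otimes> Id C Y) \<cdot> ?Q"
    by (subst Tens_tensor_comult) simp_all
  finally have L: "(D \<otimes> Id C (X \<otimes>\<^sub>o Y)) \<cdot> D = (Id C X \<otimes> ((?c \<otimes> Id C Y \<otimes> Id C X) \<cdot> (Id C X \<otimes> Sym C X (Y \<otimes>\<^sub>o Y))) \<otimes> Id C Y) \<cdot> ?Q"
    using A.interchange'[of "Id C X" "Id C X" "Id C X \<otimes> Sym C X (Y \<otimes>\<^sub>o Y) \<otimes> Id C Y" "?c \<otimes> Id C (Y \<otimes>\<^sub>o X) \<otimes> Id C Y"]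
      A.interchange'[of "Id C X \<otimes> Sym C X (Y \<otimes>\<^sub>o Y)" "?c \<otimes> Id C Y \<otimes> Id C X" "Id C Y" "Id C Y"]
    by (simp add: A.Tens_Id_Id flip: A.Comp_assoc')
  have "(Id C (X \<otimes>\<^sub>o Y) \<otimes> D) \<cdot> D
      = (Id C (X \<otimes>\<^sub>o Y) \<otimes> (Id C X \<otimes> ?c \<otimes> Id C Y)) \<cdot> ((Id C X \<otimes> Id C Y \<otimes> \<delta> \<otimes> \<delta>') \<cdot> D)"
    using A.interchange'[of "Id C (X \<otimes>\<^sub>o Y)" "Id C (X \<otimes>\<^sub>o Y)" "\<delta> \<otimes> \<delta>'" "Id C X \<otimes> ?c \<otimes> Id C Y"]
    by (simp add: A.tensor_comult_def A.Tens_Id_Id flip: A.Comp_assoc')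
  also have "(Id C X \<otimes> Id C Y \<otimes> \<delta> \<otimes> \<delta>') \<cdot> D = (Id C X \<otimes> Sym C (X \<otimes>\<^sub>o X) Y \<otimes> Id C (Y \<otimes>\<^sub>o Y)) \<cdot> ?Q"
    by (subst Tens_tensor_comult) (simp_all add: A.comult_coassoc B.comult_coassoc)
  finally have "(Id C (X \<otimes>\<^sub>o Y) \<otimes> D) \<cdot> D = (Id C X \<otimes> ((Id C Y \<otimes> Id C X \<otimes> ?c) \<cdot> (Sym C (X \<otimes>\<^sub>o X) Y \<otimes> Id C Y)) \<otimes> Id C Y) \<cdot> ?Q"
    using A.interchange'[of "Id C X" "Id C X" "Sym C (X \<otimes>\<^sub>o X) Y \<otimes> Id C Y \<otimes> Id C Y" "Id C Y \<otimes> Id C X \<otimes> ?c \<otimes> Id C Y"]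
      A.interchange'[of "Sym C (X \<otimes>\<^sub>o X) Y \<otimes> Id C Y" "Id C Y \<otimes> Id C X \<otimes> ?c" "Id C Y" "Id C Y"]
    by (simp add: A.Tens_Id_Id flip: A.Comp_assoc')
  then show ?thesis
    unfolding L inner by (rule sym)
qed

lemma counit_counit: "(e \<otimes> e) \<cdot> \<delta> = e" "(e' \<otimes> e') \<cdot> \<delta>' = e'"
  using A.pairing_counit(1)[of e] B.pairing_counit(1)[of e'] by (simp_all add: A.pairing_def)

lemma cocomm_comonoid_tensor: "A.cocomm_comonoid (X \<otimes>\<^sub>o Y) D (e \<otimes> e')"
proof -
  have "(e \<otimes> e' \<otimes> Id C X \<otimes> Id C Y) \<cdot> D = Id C (X \<otimes>\<^sub>o Y)"
    by (subst Tens_tensor_comult) (simp_all add: A.comult_counit_left B.comult_counit_left)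
  then show ?thesis
    unfolding A.cocomm_comonoid_def by (simp add: tensor_comult_coassoc tensor_comult_cocomm)
qed

lemma comonoid_hom_fst: "A.comonoid_hom (X \<otimes>\<^sub>o Y) D (e \<otimes> e') X \<delta> e (Id C X \<otimes> e')"
proof -
  have "(Id C X \<otimes> e' \<otimes> Id C X \<otimes> e') \<cdot> D = \<delta> \<otimes> e'"
    by (subst Tens_tensor_comult) (simp_all add: counit_counit)
  moreover have "\<delta> \<cdot> (Id C X \<otimes> e') = \<delta> \<otimes> e'"
    using A.interchange'[of "Id C X" \<delta> e' "Id C \<I>"] by simp
  moreover have "e \<cdot> (Id C X \<otimes> e') = e \<otimes> e'"
    using A.interchange'[of "Id C X" e e' "Id C \<I>"] by simp
  ultimately show ?thesis
    by (simp add: A.comonoid_hom_def)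
qed

lemma comonoid_hom_snd: "A.comonoid_hom (X \<otimes>\<^sub>o Y) D (e \<otimes> e') Y \<delta>' e' (e \<otimes> Id C Y)"
proof -
  have "(e \<otimes> Id C Y \<otimes> e \<otimes> Id C Y) \<cdot> D = e \<otimes> \<delta>'"
    by (subst Tens_tensor_comult) (simp_all add: counit_counit)
  moreover have "\<delta>' \<cdot> (e \<otimes> Id C Y) = e \<otimes> \<delta>'"
    using A.interchange'[of e "Id C \<I>" "Id C Y" \<delta>'] by simp
  moreover have "e' \<cdot> (e \<otimes> Id C Y) = e \<otimes> e'"
    using A.interchange'[of e "Id C \<I>" "Id C Y" e'] by simp
  ultimately show ?thesis
    by (simp add: A.comonoid_hom_def)
qed

text \<open>The two projections form a generic pair: evaluating an arrow on them returns the arrow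
  itself, which is what reduces equations of arrows to computations with points.\<close>

lemma pairing_fst_snd: "A.pairing D (Id C X \<otimes> e') (e \<otimes> Id C Y) = Id C (X \<otimes>\<^sub>o Y)"
  unfolding A.pairing_def
  using Tens_tensor_comult[of "Id C X" e' e "Id C Y"]
  by (simp add: A.comult_counit_right B.comult_counit_left)

end


section \<open>The group of points of a cocommutative Hopf algebra\<close>

context cocommutative_hopf_algebra
begin

lemma hopf_simps [simp]:
  "H \<in> Obj C"
  "\<mu> \<in> Arr C" "Dom C \<mu> = H \<otimes>\<^sub>o H" "Cod C \<mu> = H"
  "\<nu> \<in> Arr C" "Dom C \<nu> = \<I>" "Cod C \<nu> = H"
  "S \<in> Arr C" "Dom C S = H" "Cod C S = H"
  using H_in_Obj mu_in_Hom nu_in_Hom S_in_Hom by (auto simp: Hom_iff)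

lemma cocomm_comonoid_hopf: "cocomm_comonoid H \<Delta> \<epsilon>"
  using H_in_Obj Delta_in_Hom eps_in_Hom coassociative left_counit cocommutative
  by (auto simp: cocomm_comonoid_def Hom_iff)

end

sublocale cocommutative_hopf_algebra \<subseteq> HC: cocommutative_comonoid C H \<Delta> \<epsilon>
  by unfold_locales (rule cocomm_comonoid_hopf)

text \<open>Generalised elements of \<open>H\<close> with parameter comonoid \<open>X\<close>. The
  instances \<open>P1\<close>, \<open>P2\<close>, \<open>P3\<close> below supply one, two and three
  independent variables.\<close>

locale hopf_points = cocommutative_hopf_algebra + cocommutative_comonoid C X \<delta> e for X \<delta> e
begin

abbreviation "point \<equiv> comonoid_hom X \<delta> e H \<Delta> \<epsilon>"

abbreviation mult (infixr "\<star>" 56) where "f \<star> g \<equiv> \<mu> \<cdot> (f \<triangle> g)"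

lemma point_simps [simp]:
  "point f \<Longrightarrow> f \<in> Arr C"
  "point f \<Longrightarrow> Dom C f = X"
  "point f \<Longrightarrow> Cod C f = H"
  "point f \<Longrightarrow> \<Delta> \<cdot> f = f \<triangle> f"
  "point f \<Longrightarrow> \<epsilon> \<cdot> f = e"
  by (fact comonoid_hom_simps(1-3,5) comult_hom)+

lemma pointI:
  "\<lbrakk>f \<in> Arr C; Dom C f = X; Cod C f = H; \<Delta> \<cdot> f = f \<triangle> f; \<epsilon> \<cdot> f = e\<rbrakk> \<Longrightarrow> point f"
  unfolding comonoid_hom_def pairing_def by blast

lemma mult_assoc [simp]:
  assumes [simp]: "f \<in> Arr C" "Dom C f = X" "Cod C f = H" "g \<in> Arr C" "Dom C g = X" "Cod C g = H"
    "h \<in> Arr C" "Dom C h = X" "Cod C h = H"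
  shows "(f \<star> g) \<star> h = f \<star> g \<star> h"
proof -
  have "(f \<star> g) \<star> h = (\<mu> \<cdot> (\<mu> \<otimes> Id C H)) \<cdot> (f \<triangle> g \<triangle> h)"
    by simp
  also have "\<dots> = f \<star> g \<star> h"
    unfolding associative by simp
  finally show ?thesis .
qed

lemma mult_unit [simp]:
  assumes [simp]: "f \<in> Arr C" "Dom C f = X" "Cod C f = H"
  shows "(\<nu> \<cdot> e) \<star> f = f" and "f \<star> \<nu> \<cdot> e = f"
proof -
  \<comment> \<open>The rule \<open>pairing_counit\<close> would collapse
    \<open>e \<triangle> f\<close> before \<open>Tens_pairing\<close> could apply.\<close>
  have "(\<nu> \<cdot> e) \<star> f = (\<mu> \<cdot> (\<nu> \<otimes> Id C H)) \<cdot> (e \<triangle> f)"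
    by (simp del: pairing_counit)
  then show "(\<nu> \<cdot> e) \<star> f = f"
    unfolding left_unit by simp
  have "f \<star> \<nu> \<cdot> e = (\<mu> \<cdot> (Id C H \<otimes> \<nu>)) \<cdot> (f \<triangle> e)"
    by (simp del: pairing_counit)
  then show "f \<star> \<nu> \<cdot> e = f"
    unfolding right_unit by simp
qed

lemma antipode_mult [simp]:
  assumes [simp]: "point f"
  shows "(S \<cdot> f) \<star> f = \<nu> \<cdot> e" and "f \<star> S \<cdot> f = \<nu> \<cdot> e"
proof -
  have "(S \<cdot> f) \<star> f = (\<mu> \<cdot> (S \<otimes> Id C H) \<cdot> \<Delta>) \<cdot> f"
    by simp
  then show "(S \<cdot> f) \<star> f = \<nu> \<cdot> e"
    unfolding left_antipode by simp
  have "f \<star> S \<cdot> f = (\<mu> \<cdot> (Id C H \<otimes> S) \<cdot> \<Delta>) \<cdot> f"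
    by simp
  then show "f \<star> S \<cdot> f = \<nu> \<cdot> e"
    unfolding right_antipode by simp
qed

text \<open>Cancellation inside words nested to the right. Here \<open>g\<close> is any arrow and
  \<open>S \<cdot> f\<close> is not yet known to be a point; the proof that the antipode is a
  comonoid morphism relies on exactly this generality.\<close>

lemma mult_cancel [simp]:
  assumes [simp]: "point f" "g \<in> Arr C" "Dom C g = X" "Cod C g = H"
  shows "(S \<cdot> f) \<star> f \<star> g = g" and "f \<star> (S \<cdot> f) \<star> g = g"
proof -
  have "(S \<cdot> f) \<star> f \<star> g = ((S \<cdot> f) \<star> f) \<star> g"
    by (simp only: mult_assoc point_simps assms Comp_simps hopf_simps)
  then show "(S \<cdot> f) \<star> f \<star> g = g"
    by (simp only: antipode_mult assms) simp
  have "f \<star> (S \<cdot> f) \<star> g = (f \<star> S \<cdot> f) \<star> g"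
    by (simp only: mult_assoc point_simps assms Comp_simps hopf_simps)
  then show "f \<star> (S \<cdot> f) \<star> g = g"
    by (simp only: antipode_mult assms) simp
qed

lemma point_unit [simp]: "point (\<nu> \<cdot> e)"
proof (rule pointI)
  have "\<Delta> \<cdot> \<nu> \<cdot> e = (\<Delta> \<cdot> \<nu>) \<cdot> e"
    by simp
  also have "\<dots> = (\<nu> \<otimes> \<nu>) \<cdot> (e \<triangle> e)"
    unfolding Delta_nu by simp
  finally show "\<Delta> \<cdot> \<nu> \<cdot> e = (\<nu> \<cdot> e) \<triangle> (\<nu> \<cdot> e)"
    by (simp del: pairing_counit)
  have "\<epsilon> \<cdot> \<nu> \<cdot> e = (\<epsilon> \<cdot> \<nu>) \<cdot> e"
    by simp
  then show "\<epsilon> \<cdot> \<nu> \<cdot> e = e"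
    by (simp only: eps_nu) simp
qed simp_all

text \<open>The bialgebra axioms make \<open>\<mu>\<close> compatible with copying up to a swap of
  the middle factors, and \<open>Sym_pairing\<close> carries out that swap by cocommutativity of
  \<open>X\<close>.\<close>

lemma point_mult [simp]:
  assumes [simp]: "point f" "point g"
  shows "point (f \<star> g)"
proof (rule pointI)
  have "\<Delta> \<cdot> (f \<star> g) = (\<Delta> \<cdot> \<mu>) \<cdot> (f \<triangle> g)"
    by simp
  also have "\<dots> = (f \<star> g) \<triangle> (f \<star> g)"
    unfolding Delta_mu by simp
  finally show "\<Delta> \<cdot> (f \<star> g) = (f \<star> g) \<triangle> (f \<star> g)" .
  have "\<epsilon> \<cdot> (f \<star> g) = (\<epsilon> \<cdot> \<mu>) \<cdot> (f \<triangle> g)"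
    by simp
  then show "\<epsilon> \<cdot> (f \<star> g) = e"
    unfolding eps_mu by simp
qed simp_all

end

section \<open>The antipode is a comonoid morphism\<close>

context cocommutative_hopf_algebra
begin

abbreviation "D\<^sub>2 \<equiv> tensor_comult H \<Delta> H \<Delta>"
abbreviation "D\<^sub>3 \<equiv> tensor_comult H \<Delta> (H \<otimes>\<^sub>o H) D\<^sub>2"

sublocale T2: two_cocommutative_comonoids C H \<Delta> \<epsilon> H \<Delta> \<epsilon>
  by unfold_locales

lemma cocomm_comonoid_2: "cocomm_comonoid (H \<otimes>\<^sub>o H) D\<^sub>2 (\<epsilon> \<otimes> \<epsilon>)"
  by (rule T2.cocomm_comonoid_tensor)

sublocale T3: two_cocommutative_comonoids C H \<Delta> \<epsilon> "H \<otimes>\<^sub>o H" D\<^sub>2 "\<epsilon> \<otimes> \<epsilon>"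
  by unfold_locales (rule cocomm_comonoid_2)

lemma cocomm_comonoid_3:
  "cocomm_comonoid (H \<otimes>\<^sub>o H \<otimes>\<^sub>o H) D\<^sub>3 (\<epsilon> \<otimes> \<epsilon> \<otimes> \<epsilon>)"
  by (rule T3.cocomm_comonoid_tensor)

sublocale P1: hopf_points C H \<mu> \<Delta> \<nu> \<epsilon> S H \<Delta> \<epsilon>
  by unfold_locales

sublocale P2: hopf_points C H \<mu> \<Delta> \<nu> \<epsilon> S "H \<otimes>\<^sub>o H" D\<^sub>2 "\<epsilon> \<otimes> \<epsilon>"
  by unfold_locales

text \<open>The shear map \<open>(x, y) \<mapsto> (x, xy)\<close> is an invertible comonoid morphism, hence so is its inverse
  \<open>(x, y) \<mapsto> (x, S(x)y)\<close>, of which the antipode is a component.\<close>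

lemma comonoid_hom_antipode: "comonoid_hom H \<Delta> \<epsilon> H \<Delta> \<epsilon> S"
proof -
  let ?p = "Id C H \<otimes> \<epsilon>" and ?q = "\<epsilon> \<otimes> Id C H"
  let ?shear = "(Id C H \<otimes> \<mu>) \<cdot> (\<Delta> \<otimes> Id C H)"
  let ?unshear = "(Id C H \<otimes> \<mu>) \<cdot> (Id C H \<otimes> S \<otimes> Id C H) \<cdot> (\<Delta> \<otimes> Id C H)"
  note [simp] = T2.comonoid_hom_fst T2.comonoid_hom_snd
  have pq: "pairing D\<^sub>2 ?p ?q = Id C (H \<otimes>\<^sub>o H)"
    by (rule T2.pairing_fst_snd)
  \<comment> \<open>As a pair of points, the first projection and the product of both, the shear map
    falls under \<open>comonoid_hom_pairing\<close>.\<close>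
  have shear: "?shear = pairing D\<^sub>2 ?p (\<mu> \<cdot> pairing D\<^sub>2 ?p ?q)"
  proof -
    have "?shear = ?shear \<cdot> pairing D\<^sub>2 ?p ?q"
      unfolding pq by simp
    also have "\<dots> = pairing D\<^sub>2 ?p (\<mu> \<cdot> pairing D\<^sub>2 ?p ?q)"
      by simp
    finally show ?thesis .
  qed
  have 1: "?shear \<cdot> ?unshear = Id C (H \<otimes>\<^sub>o H)"
  proof -
    \<comment> \<open>On the generic pair the composite becomes (x, y) \<mapsto> (x, x S(x) y), and
      \<open>mult_cancel\<close> finishes.\<close>
    have "?shear \<cdot> ?unshear = (?shear \<cdot> ?unshear) \<cdot> pairing D\<^sub>2 ?p ?q"
      unfolding pq by simp
    also have "\<dots> = pairing D\<^sub>2 ?p ?q"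
      by simp
    finally show ?thesis
      unfolding pq .
  qed
  have 2: "?unshear \<cdot> ?shear = Id C (H \<otimes>\<^sub>o H)"
  proof -
    have "?unshear \<cdot> ?shear = (?unshear \<cdot> ?shear) \<cdot> pairing D\<^sub>2 ?p ?q"
      unfolding pq by simp
    also have "\<dots> = pairing D\<^sub>2 ?p ?q"
      by simp
    finally show ?thesis
      unfolding pq .
  qed
  have "comonoid_hom (H \<otimes>\<^sub>o H) D\<^sub>2 (\<epsilon> \<otimes> \<epsilon>) (H \<otimes>\<^sub>o H) D\<^sub>2 (\<epsilon> \<otimes> \<epsilon>) ?shear"
    unfolding shear by (rule T3.B.comonoid_hom_pairing) (simp_all add: cocomm_comonoid_hopf)
  then have "comonoid_hom (H \<otimes>\<^sub>o H) D\<^sub>2 (\<epsilon> \<otimes> \<epsilon>) (H \<otimes>\<^sub>o H) D\<^sub>2 (\<epsilon> \<otimes> \<epsilon>) ?unshear"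
    by (rule comonoid_hom_inverse[OF cocomm_comonoid_2 cocomm_comonoid_2 _ _ _ _ 1 2]) simp_all
  moreover have id: "comonoid_hom H \<Delta> \<epsilon> H \<Delta> \<epsilon> (Id C H)"
    by (rule P1.pointI) (simp_all add: pairing_def)
  then have "comonoid_hom H \<Delta> \<epsilon> (H \<otimes>\<^sub>o H) D\<^sub>2 (\<epsilon> \<otimes> \<epsilon>) (pairing \<Delta> (Id C H) (\<nu> \<cdot> \<epsilon>))"
    by (rule HC.comonoid_hom_pairing) (simp_all add: cocomm_comonoid_hopf)
  ultimately have "comonoid_hom H \<Delta> \<epsilon> (H \<otimes>\<^sub>o H) D\<^sub>2 (\<epsilon> \<otimes> \<epsilon>) (?unshear \<cdot> pairing \<Delta> (Id C H) (\<nu> \<cdot> \<epsilon>))"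
    using comonoid_hom_Comp cocomm_comonoid_hopf cocomm_comonoid_2 by blast
  then have "comonoid_hom H \<Delta> \<epsilon> H \<Delta> \<epsilon> (?q \<cdot> ?unshear \<cdot> pairing \<Delta> (Id C H) (\<nu> \<cdot> \<epsilon>))"
    using comonoid_hom_Comp[OF cocomm_comonoid_hopf cocomm_comonoid_2 cocomm_comonoid_hopf]
      T2.comonoid_hom_snd by simp
  moreover have "?q \<cdot> ?unshear \<cdot> pairing \<Delta> (Id C H) (\<nu> \<cdot> \<epsilon>) = S"
  proof -
    \<comment> \<open>A variable point \<open>i\<close> keeps the rule for
      \<open>\<Delta> \<cdot> i\<close> applicable; with \<open>Id C H\<close> in its place the
      composite would reduce to \<open>\<Delta>\<close> and not become a pair of copies.\<close>
    have "?q \<cdot> ?unshear \<cdot> pairing \<Delta> i (\<nu> \<cdot> \<epsilon>) = S \<cdot> i" if "comonoid_hom H \<Delta> \<epsilon> H \<Delta> \<epsilon> i" for i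
      using that by simp
    from this[OF id] show ?thesis
      by simp
  qed
  ultimately show ?thesis
    by simp
qed

end


section \<open>Inverses in the group of points\<close>

context hopf_points
begin

lemma point_antipode [simp]: "point f \<Longrightarrow> point (S \<cdot> f)"
  using comonoid_hom_Comp[OF comonoid cocomm_comonoid_hopf cocomm_comonoid_hopf _ comonoid_hom_antipode] .

lemma point_eqI:
  assumes [simp]: "point f" "point g" "point h" and fg: "f \<star> g = h \<star> g"
  shows "f = h"
proof -
  have "f = (f \<star> g) \<star> S \<cdot> g"
    by simp
  also have "\<dots> = h"
    unfolding fg by simp
  finally show ?thesis .
qed

text \<open>Both sides are left inverses of \<open>S \<cdot> f\<close>. This makes the antipode an
  involution, hence its own inverse.\<close>

lemma antipode_antipode [simp]: "point f \<Longrightarrow> S \<cdot> S \<cdot> f = f"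
  by (rule point_eqI[of _ "S \<cdot> f"]) simp_all

text \<open>Both sides are left inverses of \<open>f \<star> g\<close>.\<close>

lemma antipode_antimult [simp]: "\<lbrakk>point f; point g\<rbrakk> \<Longrightarrow> S \<cdot> (f \<star> g) = (S \<cdot> g) \<star> S \<cdot> f"
  by (rule point_eqI[of _ "f \<star> g"]) (simp_all del: antipode_mult add: antipode_mult(1))

end

section \<open>The rack and its braiding\<close>

context symmetric_category
begin

lemma Inv_eqI:
  assumes "is_inverse C f g"
  shows "Inv C f = g"
  unfolding Inv_def
proof (rule the_equality[where P = "is_inverse C f", OF assms])
  fix h
  assume h: "is_inverse C f h"
  note [simp] = assms[unfolded is_inverse_def Hom_iff] h[unfolded is_inverse_def Hom_iff]
  have "g \<cdot> f \<cdot> h = (g \<cdot> f) \<cdot> h"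
    by (subst Comp_assoc') simp_all
  then show "h = g"
    by simp
qed

text \<open>The values of \<open>k\<close> and \<open>i\<close> that occur in the axioms. The rules
  contain the literal \<open>1\<close>, so their later uses delete \<open>One_nat_def\<close>, which
  would rewrite it to \<open>Suc 0\<close>.\<close>

lemma on_strand_simps:
  assumes "V \<in> Obj C" "f \<in> Arr C"
  shows "on_strand C V 0 f 1 = f"
    and "on_strand C V 1 f 1 = f \<otimes> Id C V"
    and "on_strand C V 1 f 2 = Id C V \<otimes> f"
    and "on_strand C V 2 f 1 = f \<otimes> Id C (V \<otimes>\<^sub>o V)"
    and "on_strand C V 2 f 2 = Id C V \<otimes> f \<otimes> Id C V"
    and "on_strand C V 2 f 3 = Id C (V \<otimes>\<^sub>o V) \<otimes> f"
  using assms by (simp_all add: on_strand_def numeral_2_eq_2 numeral_3_eq_3)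

lemma strand_power_comult:
  assumes "V \<in> Obj C" "f \<in> Arr C" "Dom C f = V" "Cod C f = V \<otimes>\<^sub>o V"
  shows "strand_power C V 1 2 f 3 = (f \<otimes> Id C (V \<otimes>\<^sub>o V)) \<cdot> (f \<otimes> Id C V) \<cdot> f"
  using assms on_strand_simps[of V f] by (simp add: numeral_3_eq_3 numeral_2_eq_2)

lemma strand_power_mult:
  assumes "V \<in> Obj C" "f \<in> Arr C" "Dom C f = V \<otimes>\<^sub>o V" "Cod C f = V"
  shows "strand_power C V 2 1 f 2 = f \<cdot> (f \<otimes> Id C V)"
  using assms on_strand_simps[of V f] by (simp add: numeral_2_eq_2)

end

context cocommutative_hopf_algebra
begin

abbreviation "lhd \<equiv> hopf_lhd C H \<mu> \<Delta> S"
abbreviation "lhd' \<equiv> hopf_lhd' C H \<mu> \<Delta> S"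
text \<open>On points \<open>\<sigma>\<close> is (x, y) \<mapsto> (y, y^-1 x y), and
  \<open>\<sigma>'\<close>, the witness for its invertibility, is (x, y) \<mapsto> (x y x^-1,
  x).\<close>

abbreviation "\<sigma> \<equiv> (Id C H \<otimes> lhd) \<cdot> (Sym C H H \<otimes> Id C H) \<cdot> (Id C H \<otimes> \<Delta>)"
abbreviation "\<sigma>' \<equiv> (lhd' \<otimes> Id C H) \<cdot> (Sym C H H \<otimes> Id C H) \<cdot> (Id C H \<otimes> Sym C H H) \<cdot> (\<Delta> \<otimes> Id C H)"

lemma point_Id: "P1.point (Id C H)"
  by (rule P1.pointI) (simp_all add: pairing_def)

lemma is_inverse_antipode: "is_inverse C S S"
  using P1.antipode_antipode[OF point_Id] by (simp add: is_inverse_def Hom_iff)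

lemma Inv_antipode: "Inv C S = S"
  by (rule Inv_eqI[OF is_inverse_antipode])

lemma lhd_eq: "lhd = \<mu> \<cdot> (\<mu> \<otimes> Id C H) \<cdot> (S \<otimes> Id C (H \<otimes>\<^sub>o H)) \<cdot> (Sym C H H \<otimes> Id C H) \<cdot> (Id C H \<otimes> \<Delta>)"
  by (simp add: hopf_lhd_def strand_power_mult on_strand_simps del: One_nat_def)

lemma lhd_simps [simp]:
  "lhd \<in> Arr C" "Dom C lhd = H \<otimes>\<^sub>o H" "Cod C lhd = H"
  by (simp_all add: lhd_eq)

lemma lhd'_eq: "lhd' = lhd \<cdot> (Id C H \<otimes> S)"
  by (simp add: hopf_lhd'_def Inv_antipode on_strand_simps del: One_nat_def)

lemma lhd'_simps [simp]:
  "lhd' \<in> Arr C" "Dom C lhd' = H \<otimes>\<^sub>o H" "Cod C lhd' = H"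
  by (simp_all add: lhd'_eq)

end

context hopf_points
begin

text \<open>The arrow performs (x, y) \<mapsto> (x, y, y) \<mapsto> (y, x, y) \<mapsto> (y^-1, x, y)
  and then multiplies.\<close>

lemma lhd_pairing [simp]: "\<lbrakk>point f; point g\<rbrakk> \<Longrightarrow> lhd \<cdot> (f \<triangle> g) = (S \<cdot> g) \<star> f \<star> g"
  by (simp add: lhd_eq)

lemma lhd'_pairing [simp]: "\<lbrakk>point f; point g\<rbrakk> \<Longrightarrow> lhd' \<cdot> (f \<triangle> g) = g \<star> f \<star> S \<cdot> g"
  by (simp add: lhd'_eq)

end

context cocommutative_hopf_algebra
begin

sublocale P3: hopf_points C H \<mu> \<Delta> \<nu> \<epsilon> S "H \<otimes>\<^sub>o H \<otimes>\<^sub>o H" D\<^sub>3 "\<epsilon> \<otimes> \<epsilon> \<otimes> \<epsilon>"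
  by unfold_locales (rule cocomm_comonoid_3)

text \<open>Take \<open>p\<close> and \<open>q\<close> to be the projections; their pairing is an
  identity, so the evaluated equation is \<open>f = g\<close>.\<close>

lemma eqI_points2:
  assumes "f \<in> Arr C" "Dom C f = H \<otimes>\<^sub>o H" "g \<in> Arr C" "Dom C g = H \<otimes>\<^sub>o H"
    and "\<And>p q. P2.point p \<Longrightarrow> P2.point q \<Longrightarrow> f \<cdot> pairing D\<^sub>2 p q = g \<cdot> pairing D\<^sub>2 p q"
  shows "f = g"
  using assms(5)[OF T2.comonoid_hom_fst T2.comonoid_hom_snd] assms(1-4)
  by (simp add: T2.pairing_fst_snd del: HC.Tens_pairing T3.B.Tens_pairing)

lemma eqI_points3:
  assumes "f \<in> Arr C" "Dom C f = H \<otimes>\<^sub>o H \<otimes>\<^sub>o H" "g \<in> Arr C" "Dom C g = H \<otimes>\<^sub>o H \<otimes>\<^sub>o H"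
    and eq: "\<And>p q r. P3.point p \<Longrightarrow> P3.point q \<Longrightarrow> P3.point r \<Longrightarrow>
      f \<cdot> pairing D\<^sub>3 p (pairing D\<^sub>3 q r) = g \<cdot> pairing D\<^sub>3 p (pairing D\<^sub>3 q r)"
  shows "f = g"
proof -
  let ?s = "\<epsilon> \<otimes> Id C (H \<otimes>\<^sub>o H)" and ?q = "Id C H \<otimes> \<epsilon>" and ?r = "\<epsilon> \<otimes> Id C H"
  note hom = comonoid_hom_Comp[OF cocomm_comonoid_3 cocomm_comonoid_2 cocomm_comonoid_hopf T3.comonoid_hom_snd]
  \<comment> \<open>The last two coordinates are the projections of
    \<open>H \<otimes>\<^sub>o H\<close> composed with the comonoid morphism \<open>?s\<close>, so
    their pairing is \<open>?s\<close> again.\<close>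
  have "pairing D\<^sub>3 (?q \<cdot> ?s) (?r \<cdot> ?s) = pairing D\<^sub>2 ?q ?r \<cdot> ?s"
    by (rule T3.B.pairing_Comp_hom[symmetric, OF T3.comonoid_hom_snd cocomm_comonoid_3]) simp_all
  then have "pairing D\<^sub>3 (?q \<cdot> ?s) (?r \<cdot> ?s) = ?s"
    unfolding T2.pairing_fst_snd by simp
  then show ?thesis
    using eq[OF T3.comonoid_hom_fst hom[OF T2.comonoid_hom_fst] hom[OF T2.comonoid_hom_snd]] assms(1-4)
    by (simp only: T3.pairing_fst_snd Comp_Id_simps)
qed

lemma rack_hopf: "rack C H \<Delta> \<epsilon> lhd lhd'"
proof (unfold_locales, goal_cases)
  case 1
  show ?case
    by (rule H_in_Obj)
next
  case 2
  show ?case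
    by (rule Delta_in_Hom)
next
  case 3
  show ?case
    by (simp add: Hom_iff)
next
  case 4
  show ?case
    using coassociative by (simp add: on_strand_simps del: One_nat_def)
next
  case 5
  \<comment> \<open>On a point both sides are four copies of \<open>i\<close>. A variable is used
    since \<open>\<Delta> \<cdot> Id C H\<close> would not become a pair.\<close>
  have "on_strand C H 2 (Sym C H H) 2 \<cdot> strand_power C H 1 2 \<Delta> 3 \<cdot> i = strand_power C H 1 2 \<Delta> 3 \<cdot> i"
    if "P1.point i" for i
    using that by (simp add: on_strand_simps strand_power_comult del: One_nat_def)
  from this[OF point_Id] show ?case
    by (simp add: on_strand_simps strand_power_comult del: One_nat_def)
next
  case 6
  \<comment> \<open>In conjugation notation this is (x^y)^z = (x^z)^(y^z); both sides normalise to
    the word z^-1 y^-1 x y z.\<close>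
  show ?case
    by (rule eqI_points3) (simp_all add: on_strand_simps strand_power_mult del: One_nat_def)
next
  case 7
  show ?case
    by (rule eqI_points2) (simp_all add: on_strand_simps del: One_nat_def)
next
  case 8
  show ?case
    by (rule eps_in_Hom)
next
  case 9
  show ?case
    by (simp add: Hom_iff)
next
  case 10
  show ?case
    by (simp add: on_strand_simps HC.comult_counit_right del: One_nat_def)
next
  case 11
  \<comment> \<open>Conjugation by y followed by conjugation by y^-1 returns x, and
    \<open>Id C H \<otimes> \<epsilon>\<close> sends the pair (x, y) to x. The next case is the
    opposite order.\<close>
  show ?case
    by (rule eqI_points2) (simp_all add: on_strand_simps del: One_nat_def)
next
  case 12
  show ?case
    by (rule eqI_points2) (simp_all add: on_strand_simps del: One_nat_def)
qed

lemma specific_braiding_hopf: "specific_braiding C H \<sigma>"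
proof (unfold_locales, goal_cases)
  case 1
  show ?case
    by (rule H_in_Obj)
next
  case 2
  show ?case
    by (simp add: Hom_iff)
next
  case 3
  have "\<sigma>' \<cdot> \<sigma> = Id C (H \<otimes>\<^sub>o H)"
    by (rule eqI_points2) simp_all
  moreover have "\<sigma> \<cdot> \<sigma>' = Id C (H \<otimes>\<^sub>o H)"
    by (rule eqI_points2) simp_all
  ultimately have "is_inverse C \<sigma> \<sigma>'"
    by (simp add: is_inverse_def Hom_iff)
  then show ?case
    unfolding invertible_def ..
next
  case 4
  \<comment> \<open>Both sides send (x, y, z) to (z, z^-1 y z, z^-1 y^-1 x y z).\<close>
  show ?case
    by (rule eqI_points3) (simp_all add: on_strand_simps del: One_nat_def)
qed

end

text \<open>Since \<open>Inv\<close> is a definite description, the conjunct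
  \<open>invertible C S\<close> certifies that the inverse antipode in \<open>hopf_lhd'\<close> is a
  genuine inverse.\<close>

theorem proposition4p18:
  fixes C :: "('o, 'm, 'z) monoidal_data_scheme" (structure)
    and H :: 'o and \<mu> \<Delta> \<nu> \<epsilon> S :: 'm
  assumes "cocommutative_hopf_algebra C H \<mu> \<Delta> \<nu> \<epsilon> S"
  shows "invertible C S
    \<and> rack C H \<Delta> \<epsilon> (hopf_lhd C H \<mu> \<Delta> S) (hopf_lhd' C H \<mu> \<Delta> S)
    \<and> specific_braiding C H
        (on_strand C H 1 (hopf_lhd C H \<mu> \<Delta> S) 2 \<cdot> on_strand C H 1 (Sym C H H) 1 \<cdot> on_strand C H 1 \<Delta> 2)"
proof -
  interpret cocommutative_hopf_algebra C H \<mu> \<Delta> \<nu> \<epsilon> S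
    by fact
  have "on_strand C H 1 lhd 2 \<cdot> on_strand C H 1 (Sym C H H) 1 \<cdot> on_strand C H 1 \<Delta> 2 = \<sigma>"
    by (simp add: on_strand_simps del: One_nat_def)
  then show ?thesis
    using is_inverse_antipode rack_hopf specific_braiding_hopf by (auto simp: invertible_def)
qed

end
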